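(* Let $\Gamma$ be a locally finite graph, $F$ a field with an absolute value $|\cdot|_{\rm v}$, and $\lambda\in F$. Then for every $v\in V(\Gamma)$ the following conditions are equivalent: (i) The vertex $v$ does not belong to the support of any eigenfunction of $A_{\Gamma,F}$ corresponding to the eigenvalue $\lambda$. (ii) The graph $\Gamma$ has an $(F,\lambda)$-propagator with finite support with respect to $v$ (in other words, $v\in L_{F,\lambda}(\Gamma)$).
   Context: A graph is an undirected graph without loops or multiple edges, with vertex set $V(\Gamma)$; $\Gamma(v)$ is the set of vertices adjacent to $v$. $\Gamma$ is locally finite if every $\Gamma(v)$ is finite (it may be infinite and disconnected). $F^{V(\Gamma)}$ is the $F$-vector space of all functions $V(\Gamma)\to F$, and $A_{\Gamma,F}:F^{V(\Gamma)}\to F^{V(\Gamma)}$ is the linear operator $(A_{\Gamma,F}(f))(v)=\sum_{u\in\Gamma(v)}f(u)$; $E$ is the identity operator. The absolute value may be trivial. An eigenfunction corresponding to the eigenvalue $\lambda$ is a nonzero $f$ with $A_{\Gamma,F}(f)=\lambda f$. The support of $f$ is $\{u: f(u)\neq 0\}$. $\delta_v\in F^{V(\Gamma)}$ is $1$ at $v$ and $0$ elsewhere. An $(F,\lambda)$-propagator of $\Gamma$ with respect to $v$ is any $f\in F^{V(\Gamma)}$ with $(A_{\Gamma,F}-\lambda E)(f)=\delta_v$. $L_{F,\lambda}(\Gamma)$ is the set of all vertices $v$ with respect to which $\Gamma$ has an $(F,\lambda)$-propagator with finite support. *)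

theory Defs
  imports Complex_Main "HOL-Library.FuncSet"
begin

text \<open>
  Undirected graphs without loops or multiple edges: an edge is a two-element set of vertices.
  The vertex set \<open>V\<close> may be infinite, and the graph need not be connected.
\<close>

locale simple_graph =
  fixes V :: "'v set" and Ed :: "'v set set"
  assumes edges_wf: "e \<in> Ed \<Longrightarrow> e \<subseteq> V \<and> card e = 2"

definition nbrs :: "'v set set \<Rightarrow> 'v \<Rightarrow> 'v set" where
  "nbrs Ed v = {u. {v, u} \<in> Ed}"

locale locally_finite_graph = simple_graph V Ed
  for V :: "'v set" and Ed :: "'v set set" +
  assumes finite_nbrs: "v \<in> V \<Longrightarrow> finite (nbrs Ed v)"

text \<open>The trivial absolute value is allowed.\<close>

definition absolute_value :: "('f::field \<Rightarrow> real) \<Rightarrow> bool" where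
  "absolute_value av \<longleftrightarrow>
     (\<forall>x. 0 \<le> av x) \<and>
     (\<forall>x. av x = 0 \<longleftrightarrow> x = 0) \<and>
     (\<forall>x y. av (x * y) = av x * av y) \<and>
     (\<forall>x y. av (x + y) \<le> av x + av y)"

text \<open>
  A function from \<open>V\<close> to the field is represented by an extensional function, i.e. one that is
  \<open>undefined\<close> outside \<open>V\<close>, so that equality in \<open>funs V\<close> is equality on \<open>V\<close>.
\<close>

definition funs :: "'v set \<Rightarrow> ('v \<Rightarrow> 'f::field) set" where
  "funs V = V \<rightarrow>\<^sub>E UNIV"

definition zero_fun :: "'v set \<Rightarrow> 'v \<Rightarrow> 'f::field" where
  "zero_fun V = (\<lambda>u\<in>V. 0)"

definition diff_fun :: "'v set \<Rightarrow> ('v \<Rightarrow> 'f::field) \<Rightarrow> ('v \<Rightarrow> 'f) \<Rightarrow> 'v \<Rightarrow> 'f" where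
  "diff_fun V f g = (\<lambda>u\<in>V. f u - g u)"

definition scale_fun :: "'v set \<Rightarrow> 'f::field \<Rightarrow> ('v \<Rightarrow> 'f) \<Rightarrow> 'v \<Rightarrow> 'f" where
  "scale_fun V c f = (\<lambda>u\<in>V. c * f u)"

definition delta :: "'v set \<Rightarrow> 'v \<Rightarrow> 'v \<Rightarrow> 'f::field" where
  "delta V v = (\<lambda>u\<in>V. if u = v then 1 else 0)"

definition supp :: "'v set \<Rightarrow> ('v \<Rightarrow> 'f::field) \<Rightarrow> 'v set" where
  "supp V f = {u \<in> V. f u \<noteq> 0}"

definition adj_op :: "'v set \<Rightarrow> 'v set set \<Rightarrow> ('v \<Rightarrow> 'f::field) \<Rightarrow> 'v \<Rightarrow> 'f" where
  "adj_op V Ed f = (\<lambda>v\<in>V. \<Sum>u\<in>nbrs Ed v. f u)"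

definition eigenfunction :: "'v set \<Rightarrow> 'v set set \<Rightarrow> 'f::field \<Rightarrow> ('v \<Rightarrow> 'f) \<Rightarrow> bool" where
  "eigenfunction V Ed lam f \<longleftrightarrow>
     f \<in> funs V \<and> f \<noteq> zero_fun V \<and> adj_op V Ed f = scale_fun V lam f"

definition propagator ::
  "'v set \<Rightarrow> 'v set set \<Rightarrow> 'f::field \<Rightarrow> 'v \<Rightarrow> ('v \<Rightarrow> 'f) \<Rightarrow> bool" where
  "propagator V Ed lam v f \<longleftrightarrow>
     f \<in> funs V \<and> diff_fun V (adj_op V Ed f) (scale_fun V lam f) = delta V v"

definition fin_prop_set :: "'v set \<Rightarrow> 'v set set \<Rightarrow> 'f::field \<Rightarrow> 'v set" where
  "fin_prop_set V Ed lam = {v \<in> V. \<exists>f. propagator V Ed lam v f \<and> finite (supp V f)}"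

end

theory Submission
  imports Defs "HOL-Library.Function_Algebras"
begin

text \<open>
  Write \<open>D = A - \<lambda>E\<close>, where \<open>A\<close> is the adjacency operator. As the graph is undirected, \<open>D\<close> is
  symmetric for the pairing \<open>\<langle>f, p\<rangle> = \<Sum>x. f x * p x\<close> between arbitrary functions \<open>f\<close> and finitely
  supported functions \<open>p\<close>; local finiteness makes \<open>D p\<close> finitely supported as well.

  If \<open>D p = \<delta>\<^sub>v\<close> with \<open>p\<close> finitely supported and \<open>D f = 0\<close>, then
  \<open>f v = \<langle>f, D p\<rangle> = \<langle>D f, p\<rangle> = 0\<close>, so \<open>v\<close> is in the support of no eigenfunction
  (lemma \<open>pairing_symmetric\<close>).

  Conversely, the space of all functions is the full algebraic dual of the space of finitely
  supported ones: a linear functional \<open>\<phi>\<close> corresponds to the function \<open>u \<mapsto> \<phi> \<delta>\<^sub>u\<close>. Suppose that no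
  finitely supported \<open>p\<close> has \<open>D p = \<delta>\<^sub>v\<close>, so that \<open>\<delta>\<^sub>v\<close> lies outside the subspace \<open>S\<close> of all
  such \<open>D p\<close>. Some linear functional \<open>\<phi>\<close> vanishes on \<open>S\<close> and is \<open>1\<close> at \<open>\<delta>\<^sub>v\<close>
  (lemma \<open>separating_functional\<close>, by extension of a basis), and the vanishing of \<open>\<phi> (D \<delta>\<^sub>u)\<close> for all
  \<open>u\<close> says that \<open>f u = \<phi> \<delta>\<^sub>u\<close> is a solution of \<open>D f = 0\<close> with \<open>f v = 1\<close>
  (lemma \<open>kernel_function_if_no_preimage\<close>).
\<close>

section \<open>Functionals on the space of functions\<close>

definition pscale :: "'f::field \<Rightarrow> ('v \<Rightarrow> 'f) \<Rightarrow> 'v \<Rightarrow> 'f" where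
  "pscale c f = (\<lambda>x. c * f x)"

interpretation fun_space: vector_space "pscale :: 'f::field \<Rightarrow> ('v \<Rightarrow> 'f) \<Rightarrow> 'v \<Rightarrow> 'f"
  by unfold_locales (auto simp: pscale_def fun_eq_iff algebra_simps)

interpretation fun_functional: vector_space_pair
  "pscale :: 'f::field \<Rightarrow> ('v \<Rightarrow> 'f) \<Rightarrow> 'v \<Rightarrow> 'f" "(*) :: 'f \<Rightarrow> 'f \<Rightarrow> 'f"
  by unfold_locales (auto simp: algebra_simps)

text \<open>A basis of \<open>S\<close> stays independent when \<open>h\<close> is added, so values can be prescribed on it.\<close>

lemma separating_functional:
  fixes S :: "('v \<Rightarrow> 'f::field) set"
  assumes S: "fun_space.subspace S" and h: "h \<notin> S"
  shows "\<exists>\<phi>. Vector_Spaces.linear pscale (*) \<phi> \<and> (\<forall>x\<in>S. \<phi> x = 0) \<and> \<phi> h = 1"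
proof -
  obtain B where B: "B \<subseteq> S" "fun_space.independent B" "S \<subseteq> fun_space.span B"
    using fun_space.maximal_independent_subset by blast
  have span_B: "fun_space.span B = S"
    using B S fun_space.span_minimal by blast
  have "fun_space.independent (insert h B)"
    using B(2) h span_B by (simp add: fun_space.independent_insertI)
  from fun_functional.linear_independent_extend[OF this, of "\<lambda>x. if x = h then 1 else 0"]
  obtain \<phi> where \<phi>: "Vector_Spaces.linear pscale (*) \<phi>"
    "\<forall>x\<in>insert h B. \<phi> x = (if x = h then 1 else 0)"
    by blast
  have "h \<notin> B" using B(1) h by blast
  then have "\<phi> x = 0" if "x \<in> B" for x
    using \<phi>(2) that by auto
  then have "\<forall>x\<in>S. \<phi> x = 0"
    using fun_functional.linear_eq_0_on_span[OF \<phi>(1)] span_B by blast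
  then show ?thesis using \<phi> by auto
qed

section \<open>The operator \<open>A - \<lambda>E\<close>\<close>

text \<open>
  Here functions on \<open>V\<close> are represented by total functions that vanish off \<open>V\<close>. These form a
  vector space under pointwise operations, while a pointwise sum of extensional functions need not
  be extensional.
\<close>

definition shifted_adj :: "'v set \<Rightarrow> 'v set set \<Rightarrow> 'f::field \<Rightarrow> ('v \<Rightarrow> 'f) \<Rightarrow> 'v \<Rightarrow> 'f" where
  "shifted_adj V Ed lam p = (\<lambda>x. if x \<in> V then (\<Sum>u\<in>nbrs Ed x. p u) - lam * p x else 0)"

definition fin_funs :: "'v set \<Rightarrow> ('v \<Rightarrow> 'f::field) set" where
  "fin_funs V = {p. finite {x. p x \<noteq> 0} \<and> {x. p x \<noteq> 0} \<subseteq> V}"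

definition unit_fun :: "'v \<Rightarrow> 'v \<Rightarrow> 'f::field" where
  "unit_fun u = (\<lambda>x. if x = u then 1 else 0)"

lemma sum_apply: "(\<Sum>i\<in>I. g i) x = (\<Sum>i\<in>I. g i x)"
  by (induction I rule: infinite_finite_induct) auto

lemma nbrs_sym: "x \<in> nbrs Ed u \<longleftrightarrow> u \<in> nbrs Ed x"
  by (simp add: nbrs_def insert_commute)

lemma (in simple_graph) nbrs_subset: "nbrs Ed v \<subseteq> V"
  using edges_wf by (force simp: nbrs_def)

lemma subspace_fin_funs:
  fixes V :: "'v set"
  shows "fun_space.subspace (fin_funs V :: ('v \<Rightarrow> 'f::field) set)"
proof (rule fun_space.subspaceI)
  fix p q :: "'v \<Rightarrow> 'f" and c :: 'f
  assume p: "p \<in> fin_funs V"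
  have "{x. c * p x \<noteq> 0} \<subseteq> {x. p x \<noteq> 0}" by auto
  with p show "pscale c p \<in> fin_funs V"
    unfolding fin_funs_def pscale_def by (auto intro: finite_subset)
  assume q: "q \<in> fin_funs V"
  have "{x. p x + q x \<noteq> 0} \<subseteq> {x. p x \<noteq> 0} \<union> {x. q x \<noteq> 0}" by auto
  with p q show "p + q \<in> fin_funs V"
    unfolding fin_funs_def by (auto intro: finite_subset)
qed (simp add: fin_funs_def)

lemma shifted_adj_add:
  "shifted_adj V Ed lam (p + q) = shifted_adj V Ed lam p + shifted_adj V Ed lam q"
  by (simp add: shifted_adj_def fun_eq_iff sum.distrib distrib_left)

lemma shifted_adj_scale:
  "shifted_adj V Ed lam (pscale c p) = pscale c (shifted_adj V Ed lam p)"
  by (auto simp: shifted_adj_def pscale_def fun_eq_iff sum_distrib_left right_diff_distrib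
      mult.left_commute)

lemma subspace_shifted_adj_image:
  fixes lam :: "'f::field" and V :: "'v set"
  shows "fun_space.subspace (shifted_adj V Ed lam ` fin_funs V)"
proof (rule fun_space.subspaceI)
  have "shifted_adj V Ed lam 0 = 0"
    by (simp add: shifted_adj_def fun_eq_iff)
  then show "0 \<in> shifted_adj V Ed lam ` fin_funs V"
    using fun_space.subspace_0[OF subspace_fin_funs] by (metis imageI)
next
  fix g h :: "'v \<Rightarrow> 'f" and c :: 'f
  assume "g \<in> shifted_adj V Ed lam ` fin_funs V"
  then obtain p where p: "p \<in> fin_funs V" "g = shifted_adj V Ed lam p" by blast
  have "pscale c p \<in> fin_funs V"
    using fun_space.subspace_scale[OF subspace_fin_funs] p(1) .
  then show "pscale c g \<in> shifted_adj V Ed lam ` fin_funs V"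
    unfolding p(2) shifted_adj_scale[symmetric] by (rule imageI)
  assume "h \<in> shifted_adj V Ed lam ` fin_funs V"
  then obtain q where q: "q \<in> fin_funs V" "h = shifted_adj V Ed lam q" by blast
  have "p + q \<in> fin_funs V"
    using fun_space.subspace_add[OF subspace_fin_funs] p(1) q(1) .
  then show "g + h \<in> shifted_adj V Ed lam ` fin_funs V"
    unfolding p(2) q(2) shifted_adj_add[symmetric] by (rule imageI)
qed

context locally_finite_graph
begin

text \<open>
  By symmetry of adjacency, the column of \<open>A - \<lambda>E\<close> at \<open>u\<close> has the same entries as its row at \<open>u\<close>.
\<close>

lemma shifted_adj_unit_fun:
  fixes lam :: "'f::field"
  assumes "u \<in> V"
  shows "shifted_adj V Ed lam (unit_fun u) =
    (\<Sum>x\<in>nbrs Ed u. unit_fun x) - pscale lam (unit_fun u)"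
proof
  fix y
  have "(\<Sum>x\<in>nbrs Ed u. unit_fun x) y = (\<Sum>x\<in>nbrs Ed u. unit_fun x y :: 'f)"
    by (rule sum_apply)
  also have "\<dots> = (if y \<in> nbrs Ed u then 1 else 0)"
    using finite_nbrs[OF assms] by (simp add: unit_fun_def)
  finally have sum_units:
    "(\<Sum>x\<in>nbrs Ed u. unit_fun x) y = (if y \<in> nbrs Ed u then 1 else 0 :: 'f)" .
  show "shifted_adj V Ed lam (unit_fun u) y =
      ((\<Sum>x\<in>nbrs Ed u. unit_fun x) - pscale lam (unit_fun u)) y"
  proof (cases "y \<in> V")
    case True
    then have "(\<Sum>x\<in>nbrs Ed y. unit_fun u x) = (if y \<in> nbrs Ed u then 1 else 0 :: 'f)"
      using finite_nbrs[OF True] by (simp add: unit_fun_def nbrs_sym[of y])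
    with True sum_units show ?thesis
      by (simp add: shifted_adj_def pscale_def)
  next
    case False
    then have "y \<notin> nbrs Ed u" "y \<noteq> u" using nbrs_subset assms by auto
    with False sum_units show ?thesis
      by (simp add: shifted_adj_def pscale_def unit_fun_def)
  qed
qed

text \<open>
  The solution is \<open>f u = \<phi> \<delta>\<^sub>u\<close> for a functional \<open>\<phi>\<close> that separates \<open>\<delta>\<^sub>v\<close> from the image. It satisfies
  the eigenvalue equation at \<open>u\<close> because \<open>\<phi>\<close> vanishes on the column at \<open>u\<close>, which is a finite
  combination of unit functions by local finiteness.
\<close>

lemma kernel_function_if_no_preimage:
  assumes "unit_fun v \<notin> shifted_adj V Ed lam ` fin_funs V"
  shows "\<exists>f. (\<forall>u\<in>V. (\<Sum>x\<in>nbrs Ed u. f x) = lam * f u) \<and> f v = 1"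
proof -
  obtain \<phi> where \<phi>: "Vector_Spaces.linear pscale (*) \<phi>"
    "\<forall>h\<in>shifted_adj V Ed lam ` fin_funs V. \<phi> h = 0" "\<phi> (unit_fun v) = 1"
    using separating_functional[OF subspace_shifted_adj_image assms] by blast
  have "(\<Sum>x\<in>nbrs Ed u. \<phi> (unit_fun x)) = lam * \<phi> (unit_fun u)" if u: "u \<in> V" for u
  proof -
    have "unit_fun u \<in> fin_funs V"
      using u by (simp add: fin_funs_def unit_fun_def)
    then have "0 = \<phi> (shifted_adj V Ed lam (unit_fun u))"
      using \<phi>(2) by (metis imageI)
    also have "\<dots> = (\<Sum>x\<in>nbrs Ed u. \<phi> (unit_fun x)) - lam * \<phi> (unit_fun u)"
      by (simp only: shifted_adj_unit_fun[OF u] fun_functional.linear_diff[OF \<phi>(1)]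
          fun_functional.linear_sum[OF \<phi>(1)] fun_functional.linear_scale[OF \<phi>(1)])
    finally show ?thesis by simp
  qed
  with \<phi>(3) show ?thesis by (intro exI[of _ "\<lambda>u. \<phi> (unit_fun u)"]) simp
qed

text \<open>
  Every nonzero term of \<open>\<Sum>x u. f x * a x u * p u\<close>, with \<open>a\<close> the adjacency matrix, has \<open>u\<close> in the
  support of \<open>p\<close> and \<open>x\<close> adjacent to \<open>u\<close>. So a finite set \<open>U\<close> containing that support and its
  neighbours carries the whole double sum, and the order of summation may be exchanged.
\<close>

lemma pairing_symmetric:
  fixes f p :: "'v \<Rightarrow> 'f::field"
  assumes U: "finite U" "U \<subseteq> V"
    and supp_U: "supp V p \<subseteq> U" and nbrs_U: "\<And>u. u \<in> supp V p \<Longrightarrow> nbrs Ed u \<subseteq> U"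
  shows "(\<Sum>x\<in>U. f x * ((\<Sum>u\<in>nbrs Ed x. p u) - lam * p x)) =
    (\<Sum>u\<in>U. p u * ((\<Sum>x\<in>nbrs Ed u. f x) - lam * f u))"
proof -
  have row: "(\<Sum>u\<in>nbrs Ed x. p u) = (\<Sum>u\<in>U. if u \<in> nbrs Ed x then p u else 0)"
    if "x \<in> U" for x
  proof -
    have "(\<Sum>u\<in>nbrs Ed x. p u) = (\<Sum>u\<in>U \<inter> nbrs Ed x. p u)"
      using that U supp_U nbrs_subset finite_nbrs
      by (intro sum.mono_neutral_right) (auto simp: supp_def)
    then show ?thesis using U(1) by (simp add: sum.inter_restrict)
  qed
  have column: "p u * (\<Sum>x\<in>nbrs Ed u. f x) = (\<Sum>x\<in>U. if x \<in> nbrs Ed u then f x * p u else 0)"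
    if "u \<in> U" for u
  proof (cases "p u = 0")
    case False
    then have "nbrs Ed u \<subseteq> U" using nbrs_U that U(2) by (auto simp: supp_def)
    then have "U \<inter> nbrs Ed u = nbrs Ed u" by blast
    then show ?thesis
      using U(1) by (simp add: sum_distrib_left mult.commute flip: sum.inter_restrict)
  qed (simp cong: if_cong)
  have "(\<Sum>x\<in>U. f x * (\<Sum>u\<in>nbrs Ed x. p u)) =
      (\<Sum>x\<in>U. \<Sum>u\<in>U. if u \<in> nbrs Ed x then f x * p u else 0)"
    by (intro sum.cong refl) (simp add: row sum_distrib_left if_distrib mult.commute cong: if_cong)
  also have "\<dots> = (\<Sum>u\<in>U. \<Sum>x\<in>U. if x \<in> nbrs Ed u then f x * p u else 0)"
    by (subst sum.swap) (intro sum.cong if_cong nbrs_sym refl)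
  also have "\<dots> = (\<Sum>u\<in>U. p u * (\<Sum>x\<in>nbrs Ed u. f x))"
    by (intro sum.cong refl) (simp add: column)
  finally have "(\<Sum>x\<in>U. f x * (\<Sum>u\<in>nbrs Ed x. p u)) = (\<Sum>u\<in>U. p u * (\<Sum>x\<in>nbrs Ed u. f x))" .
  moreover have "(\<Sum>x\<in>U. f x * (lam * p x)) = (\<Sum>x\<in>U. p x * (lam * f x))"
    by (intro sum.cong refl) (simp only: mult.left_commute[of _ lam] mult.commute[of "f _"])
  ultimately show ?thesis
    by (simp only: right_diff_distrib sum_subtractf)
qed

section \<open>Eigenfunctions and propagators\<close>

lemma eigenfunction_sum:
  assumes "eigenfunction V Ed lam f" "u \<in> V"
  shows "(\<Sum>x\<in>nbrs Ed u. f x) = lam * f u"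
proof -
  have "adj_op V Ed f u = scale_fun V lam f u"
    using assms(1) by (simp add: eigenfunction_def)
  with assms(2) show ?thesis by (simp add: adj_op_def scale_fun_def)
qed

lemma propagator_sum:
  assumes "propagator V Ed lam v p" "u \<in> V"
  shows "(\<Sum>x\<in>nbrs Ed u. p x) - lam * p u = (if u = v then 1 else 0)"
proof -
  have "diff_fun V (adj_op V Ed p) (scale_fun V lam p) u = delta V v u"
    using assms(1) by (simp add: propagator_def)
  with assms(2) show ?thesis
    by (simp add: adj_op_def scale_fun_def diff_fun_def delta_def del: right_minus_eq)
qed

lemma eigenfunction_zero_if_propagator:
  assumes v: "v \<in> V" and p: "propagator V Ed lam v p" "finite (supp V p)"
    and f: "eigenfunction V Ed lam f"
  shows "f v = 0"
proof -
  define U where "U = insert v (supp V p \<union> (\<Union>u\<in>supp V p. nbrs Ed u))"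
  have "finite U"
    using p(2) finite_nbrs by (auto simp: U_def supp_def)
  have vU: "v \<in> U" by (simp add: U_def)
  have "U \<subseteq> V"
    using v nbrs_subset by (auto simp: U_def supp_def)
  have "f v = (\<Sum>x\<in>U. f x * (if x = v then 1 else 0))"
    using \<open>finite U\<close> vU by (simp add: if_distrib cong: if_cong)
  also have "\<dots> = (\<Sum>x\<in>U. f x * ((\<Sum>u\<in>nbrs Ed x. p u) - lam * p x))"
    by (intro sum.cong refl arg_cong2[where f = "(*)"] propagator_sum[OF p(1), symmetric]
        subsetD[OF \<open>U \<subseteq> V\<close>])
  also have "\<dots> = (\<Sum>u\<in>U. p u * ((\<Sum>x\<in>nbrs Ed u. f x) - lam * f u))"
    using \<open>finite U\<close> \<open>U \<subseteq> V\<close> by (intro pairing_symmetric) (auto simp: U_def)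
  also have "\<dots> = 0"
    using eigenfunction_sum[OF f] \<open>U \<subseteq> V\<close> by (intro sum.neutral) auto
  finally show ?thesis .
qed

lemma eigenfunction_restrict:
  assumes f: "\<forall>u\<in>V. (\<Sum>x\<in>nbrs Ed u. f x) = lam * f u" and v: "v \<in> V" "f v \<noteq> 0"
  shows "eigenfunction V Ed lam (restrict f V)"
proof -
  have "restrict f V \<noteq> zero_fun V"
  proof
    assume "restrict f V = zero_fun V"
    then have "restrict f V v = zero_fun V v" by simp
    with v show False by (simp add: Defs.zero_fun_def)
  qed
  moreover have "(\<Sum>x\<in>nbrs Ed u. restrict f V x) = (\<Sum>x\<in>nbrs Ed u. f x)" for u
    using nbrs_subset[of u] by (intro sum.cong) auto
  ultimately show ?thesis
    using f by (auto simp: eigenfunction_def funs_def adj_op_def scale_fun_def fun_eq_iff)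
qed

lemma propagator_restrict:
  assumes p: "p \<in> fin_funs V" and v: "unit_fun v = shifted_adj V Ed lam p"
  shows "propagator V Ed lam v (restrict p V) \<and> finite (supp V (restrict p V))"
proof
  have "(\<Sum>x\<in>nbrs Ed u. restrict p V x) = (\<Sum>x\<in>nbrs Ed u. p x)" for u
    using nbrs_subset[of u] by (intro sum.cong) auto
  then show "propagator V Ed lam v (restrict p V)"
    using fun_cong[OF v]
    by (auto simp: propagator_def funs_def adj_op_def scale_fun_def diff_fun_def delta_def
        shifted_adj_def unit_fun_def fun_eq_iff)
  have "supp V (restrict p V) \<subseteq> {x. p x \<noteq> 0}" by (auto simp: supp_def)
  then show "finite (supp V (restrict p V))"
    using p finite_subset by (auto simp: fin_funs_def)
qed

lemma finite_propagator_iff: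
  assumes v: "v \<in> V"
  shows "(\<forall>f. eigenfunction V Ed lam f \<longrightarrow> v \<notin> supp V f) \<longleftrightarrow>
    (\<exists>p. propagator V Ed lam v p \<and> finite (supp V p))"
proof
  assume no_eigenfunction: "\<forall>f. eigenfunction V Ed lam f \<longrightarrow> v \<notin> supp V f"
  show "\<exists>p. propagator V Ed lam v p \<and> finite (supp V p)"
  proof (cases "unit_fun v \<in> shifted_adj V Ed lam ` fin_funs V")
    case True
    then show ?thesis using propagator_restrict by blast
  next
    case False
    then obtain f where f: "\<forall>u\<in>V. (\<Sum>x\<in>nbrs Ed u. f x) = lam * f u" "f v = 1"
      using kernel_function_if_no_preimage by blast
    then have "eigenfunction V Ed lam (restrict f V)"
      using v by (intro eigenfunction_restrict) auto
    moreover have "v \<in> supp V (restrict f V)"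
      using v f(2) by (simp add: supp_def)
    ultimately show ?thesis using no_eigenfunction by blast
  qed
next
  assume "\<exists>p. propagator V Ed lam v p \<and> finite (supp V p)"
  then show "\<forall>f. eigenfunction V Ed lam f \<longrightarrow> v \<notin> supp V f"
    using eigenfunction_zero_if_propagator[OF v] by (auto simp: supp_def)
qed

end

theorem mainTheorem2:
  fixes V :: "'v set" and Ed :: "'v set set"
    and av :: "'f::field \<Rightarrow> real" and lam :: 'f
  assumes "locally_finite_graph V Ed"
    and "absolute_value av"
  shows "\<forall>v\<in>V.
    ((\<forall>f. eigenfunction V Ed lam f \<longrightarrow> v \<notin> supp V f) \<longleftrightarrow>
       (\<exists>f. propagator V Ed lam v f \<and> finite (supp V f))) \<and>
    ((\<exists>f. propagator V Ed lam v f \<and> finite (supp V f)) \<longleftrightarrow>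
       v \<in> fin_prop_set V Ed lam)"
proof
  fix v assume v: "v \<in> V"
  show "((\<forall>f. eigenfunction V Ed lam f \<longrightarrow> v \<notin> supp V f) \<longleftrightarrow>
       (\<exists>f. propagator V Ed lam v f \<and> finite (supp V f))) \<and>
    ((\<exists>f. propagator V Ed lam v f \<and> finite (supp V f)) \<longleftrightarrow>
       v \<in> fin_prop_set V Ed lam)"
    using locally_finite_graph.finite_propagator_iff[OF assms(1) v, of lam] v
    unfolding fin_prop_set_def by blast
qed

end
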